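(* Let $\mathcal{G}$ be a (non-empty) finite groupoid and let $S$ be a $\mathcal{G}$-monoid. Then the slice category $\mathbf{set}^{\mathcal{G}}/\overline{S}$ is a monoidal category, with the tensor product $\otimes$, unit object $I$, associator $\alpha$, and left and right unitors $l$, $r$ specified in the context.
   Context: A groupoid is a category in which every morphism is invertible; it is finite if it has finitely many objects and morphisms. $\mathcal{G}_0$ is the set of objects. $\mathbf{set}$ is the category of finite sets and $\mathbf{mon}$ the category of finite monoids; $1_M$ is the unit of a monoid $M$. $\mathbf{set}^{\mathcal{G}}$ is the category of functors $\mathcal{G}\to\mathbf{set}$ ($\mathcal{G}$-sets) and natural transformations ($\mathcal{G}$-maps). A $\mathcal{G}$-monoid is a functor $S:\mathcal{G}\to\mathbf{mon}$; $\overline{S}$ denotes its underlying $\mathcal{G}$-set (composite with the forgetful functor $\mathbf{mon}\to\mathbf{set}$). Structure on $\mathbf{set}^{\mathcal{G}}/\overline{S}$: - Tensor product: for objects $\theta:X\to\overline{S}$ and $\tau:Y\to\overline{S}$, $\theta\otimes\tau:X\times Y\to\overline{S}$ has component at $G\in\mathcal{G}_0$ the map $X(G)\times Y(G)\to\overline{S}(G)$, $(x,y)\mapsto\theta_G(x)\tau_G(y)$ (product in the monoid $S(G)$). For morphisms given by $\mathcal{G}$-maps $\eta:X\to X'$ and $\sigma:Y\to Y'$ over $\overline{S}$, $\eta\otimes\sigma$ has components $\eta_G\times\sigma_G$. - Unit object: $I:1\to\overline{S}$, where $1$ is the terminal $\mathcal{G}$-set, whose component at $G$ sends the unique element to $1_{S(G)}$.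 - Associator $\alpha_{X,Y,Z}:(X\otimes Y)\otimes Z\to X\otimes(Y\otimes Z)$ with components $((x,y),z)\mapsto(x,(y,z))$. - Left unitor $l_X:I\otimes X\to X$ and right unitor $r_X:X\otimes I\to X$ with components the projections $(\bullet,x)\mapsto x$ and $(x,\bullet)\mapsto x$, where $\bullet$ is the unique element of $1(G)$. *)

theory Defs
  imports "HOL-Algebra.Group" "HOL-Library.FuncSet"
begin

section \<open>Categories, functors, natural transformations\<close>

record ('o, 'm) cat =
  Obj :: "'o set"
  Arr :: "'m set"
  Dom :: "'m \<Rightarrow> 'o"
  Cod :: "'m \<Rightarrow> 'o"
  Ide :: "'o \<Rightarrow> 'm"
  Comp :: "'m \<Rightarrow> 'm \<Rightarrow> 'm"  (infixl "\<cdot>\<index>" 70)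

text \<open>Composition is written in applicative order: \<open>g \<cdot>\<^bsub>C\<^esub> f\<close> is \<open>f\<close> followed by \<open>g\<close>.
  It is meaningful only if \<open>Cod C f = Dom C g\<close>.\<close>

definition Hom :: "('o, 'm) cat \<Rightarrow> 'o \<Rightarrow> 'o \<Rightarrow> 'm set" where
  "Hom C a b = {f \<in> Arr C. Dom C f = a \<and> Cod C f = b}"

locale category =
  fixes C :: "('o, 'm) cat" (structure)
  assumes Dom_Obj: "f \<in> Arr C \<Longrightarrow> Dom C f \<in> Obj C"
    and Cod_Obj: "f \<in> Arr C \<Longrightarrow> Cod C f \<in> Obj C"
    and Ide_Hom: "a \<in> Obj C \<Longrightarrow> Ide C a \<in> Hom C a a"
    and Comp_Hom: "\<lbrakk>f \<in> Hom C a b; g \<in> Hom C b c\<rbrakk> \<Longrightarrow> g \<cdot> f \<in> Hom C a c"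
    and Comp_Ide_right: "f \<in> Hom C a b \<Longrightarrow> f \<cdot> Ide C a = f"
    and Comp_Ide_left: "f \<in> Hom C a b \<Longrightarrow> Ide C b \<cdot> f = f"
    and Comp_assoc: "\<lbrakk>f \<in> Hom C a b; g \<in> Hom C b c; h \<in> Hom C c d\<rbrakk>
      \<Longrightarrow> (h \<cdot> g) \<cdot> f = h \<cdot> (g \<cdot> f)"

definition invertible_arr :: "('o, 'm) cat \<Rightarrow> 'm \<Rightarrow> bool" where
  "invertible_arr C f \<longleftrightarrow> f \<in> Arr C \<and>
     (\<exists>g \<in> Hom C (Cod C f) (Dom C f).
        g \<cdot>\<^bsub>C\<^esub> f = Ide C (Dom C f) \<and> f \<cdot>\<^bsub>C\<^esub> g = Ide C (Cod C f))"

locale groupoid = category +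
  assumes all_invertible: "f \<in> Arr C \<Longrightarrow> invertible_arr C f"

locale finite_groupoid = groupoid +
  assumes finite_Obj: "finite (Obj C)"
    and finite_Arr: "finite (Arr C)"

definition product_cat :: "('o, 'm) cat \<Rightarrow> ('p, 'n) cat \<Rightarrow> ('o \<times> 'p, 'm \<times> 'n) cat" where
  "product_cat C D = \<lparr>
     Obj = Obj C \<times> Obj D,
     Arr = Arr C \<times> Arr D,
     Dom = (\<lambda>(f, g). (Dom C f, Dom D g)),
     Cod = (\<lambda>(f, g). (Cod C f, Cod D g)),
     Ide = (\<lambda>(a, b). (Ide C a, Ide D b)),
     Comp = (\<lambda>(f', g') (f, g). (f' \<cdot>\<^bsub>C\<^esub> f, g' \<cdot>\<^bsub>D\<^esub> g))\<rparr>"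

record ('o, 'm, 'p, 'n) fctr =
  fobj :: "'o \<Rightarrow> 'p"
  farr :: "'m \<Rightarrow> 'n"

definition is_functor :: "('o, 'm) cat \<Rightarrow> ('p, 'n) cat \<Rightarrow> ('o, 'm, 'p, 'n) fctr \<Rightarrow> bool" where
  "is_functor C D F \<longleftrightarrow>
     (\<forall>a \<in> Obj C. fobj F a \<in> Obj D) \<and>
     (\<forall>f \<in> Arr C. farr F f \<in> Hom D (fobj F (Dom C f)) (fobj F (Cod C f))) \<and>
     (\<forall>a \<in> Obj C. farr F (Ide C a) = Ide D (fobj F a)) \<and>
     (\<forall>f \<in> Arr C. \<forall>g \<in> Arr C. Cod C f = Dom C g \<longrightarrow>
        farr F (g \<cdot>\<^bsub>C\<^esub> f) = farr F g \<cdot>\<^bsub>D\<^esub> farr F f)"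

definition comp_functor ::
  "('o, 'm) cat \<Rightarrow> ('p, 'n, 'q, 'k) fctr \<Rightarrow> ('o, 'm, 'p, 'n) fctr \<Rightarrow> ('o, 'm, 'q, 'k) fctr" where
  "comp_functor C K F = \<lparr>
     fobj = (\<lambda>a \<in> Obj C. fobj K (fobj F a)),
     farr = (\<lambda>f \<in> Arr C. farr K (farr F f))\<rparr>"

text \<open>Arrows of the concrete categories below: a source, a target and the underlying data.\<close>

record ('c, 'd) arrow =
  src :: 'c
  trg :: 'c
  app :: 'd

text \<open>A natural transformation is recorded with its source and target functor; \<open>app \<eta> a\<close> is its
  component at \<open>a\<close>.\<close>

definition nat_trans ::
  "('o, 'm) cat \<Rightarrow> ('p, 'n) cat \<Rightarrow> (('o, 'm, 'p, 'n) fctr, 'o \<Rightarrow> 'n) arrow \<Rightarrow> bool" where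
  "nat_trans C D \<eta> \<longleftrightarrow>
     is_functor C D (src \<eta>) \<and> is_functor C D (trg \<eta>) \<and>
     (\<forall>a \<in> Obj C. app \<eta> a \<in> Hom D (fobj (src \<eta>) a) (fobj (trg \<eta>) a)) \<and>
     (\<forall>f \<in> Arr C. app \<eta> (Cod C f) \<cdot>\<^bsub>D\<^esub> farr (src \<eta>) f = farr (trg \<eta>) f \<cdot>\<^bsub>D\<^esub> app \<eta> (Dom C f))"

text \<open>Extensionality outside the source category makes equality of functors and of natural
  transformations the mathematical one.\<close>

definition ext_functor :: "('o, 'm) cat \<Rightarrow> ('o, 'm, 'p, 'n) fctr \<Rightarrow> bool" where
  "ext_functor C F \<longleftrightarrow> fobj F \<in> extensional (Obj C) \<and> farr F \<in> extensional (Arr C)"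

definition functor_cat :: "('o, 'm) cat \<Rightarrow> ('p, 'n) cat \<Rightarrow>
    (('o, 'm, 'p, 'n) fctr, (('o, 'm, 'p, 'n) fctr, 'o \<Rightarrow> 'n) arrow) cat" where
  "functor_cat C D = \<lparr>
     Obj = {F. is_functor C D F \<and> ext_functor C F},
     Arr = {\<eta>. nat_trans C D \<eta> \<and> ext_functor C (src \<eta>) \<and> ext_functor C (trg \<eta>) \<and>
               app \<eta> \<in> extensional (Obj C)},
     Dom = src,
     Cod = trg,
     Ide = (\<lambda>F. \<lparr>src = F, trg = F, app = (\<lambda>a \<in> Obj C. Ide D (fobj F a))\<rparr>),
     Comp = (\<lambda>\<tau> \<eta>. \<lparr>src = src \<eta>, trg = trg \<tau>, app = (\<lambda>a \<in> Obj C. app \<tau> a \<cdot>\<^bsub>D\<^esub> app \<eta> a)\<rparr>)\<rparr>"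

text \<open>The objects of the slice category over \<open>s\<close> are the arrows into \<open>s\<close>; an arrow
  from \<open>\<theta>\<close> to \<open>\<theta>'\<close> is an arrow \<open>h\<close> between their domains with \<open>\<theta>' \<cdot> h = \<theta>\<close>.\<close>

definition slice_cat :: "('o, 'm) cat \<Rightarrow> 'o \<Rightarrow> ('m, ('m, 'm) arrow) cat" where
  "slice_cat D s = \<lparr>
     Obj = {\<theta> \<in> Arr D. Cod D \<theta> = s},
     Arr = {h. src h \<in> Arr D \<and> Cod D (src h) = s \<and>
               trg h \<in> Arr D \<and> Cod D (trg h) = s \<and>
               app h \<in> Hom D (Dom D (src h)) (Dom D (trg h)) \<and>
               trg h \<cdot>\<^bsub>D\<^esub> app h = src h},
     Dom = src,
     Cod = trg,
     Ide = (\<lambda>\<theta>. \<lparr>src = \<theta>, trg = \<theta>, app = Ide D (Dom D \<theta>)\<rparr>),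
     Comp = (\<lambda>k h. \<lparr>src = src h, trg = trg k, app = app k \<cdot>\<^bsub>D\<^esub> app h\<rparr>)\<rparr>"


section \<open>Monoidal categories\<close>

locale monoidal_category = category C
  for C :: "('o, 'm) cat" (structure) +
  fixes tobj :: "'o \<Rightarrow> 'o \<Rightarrow> 'o"  (infixl "\<boxtimes>" 75)
    and tarr :: "'m \<Rightarrow> 'm \<Rightarrow> 'm"  (infixl "\<boxtimes>\<^sub>a" 75)
    and unit :: 'o
    and assoc :: "'o \<Rightarrow> 'o \<Rightarrow> 'o \<Rightarrow> 'm"
    and lunit :: "'o \<Rightarrow> 'm"
    and runit :: "'o \<Rightarrow> 'm"
  assumes tensor_functor:
      "is_functor (product_cat C C) C
         \<lparr>fobj = (\<lambda>(a, b). a \<boxtimes> b), farr = (\<lambda>(f, g). f \<boxtimes>\<^sub>a g)\<rparr>"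
    and unit_Obj: "unit \<in> Obj C"
    and assoc_Hom: "\<lbrakk>a \<in> Obj C; b \<in> Obj C; c \<in> Obj C\<rbrakk>
      \<Longrightarrow> assoc a b c \<in> Hom C ((a \<boxtimes> b) \<boxtimes> c) (a \<boxtimes> (b \<boxtimes> c))"
    and assoc_invertible: "\<lbrakk>a \<in> Obj C; b \<in> Obj C; c \<in> Obj C\<rbrakk> \<Longrightarrow> invertible_arr C (assoc a b c)"
    and assoc_natural: "\<lbrakk>f \<in> Hom C a a'; g \<in> Hom C b b'; h \<in> Hom C c c'\<rbrakk>
      \<Longrightarrow> assoc a' b' c' \<cdot> ((f \<boxtimes>\<^sub>a g) \<boxtimes>\<^sub>a h) = (f \<boxtimes>\<^sub>a (g \<boxtimes>\<^sub>a h)) \<cdot> assoc a b c"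
    and lunit_Hom: "a \<in> Obj C \<Longrightarrow> lunit a \<in> Hom C (unit \<boxtimes> a) a"
    and lunit_invertible: "a \<in> Obj C \<Longrightarrow> invertible_arr C (lunit a)"
    and lunit_natural: "f \<in> Hom C a a' \<Longrightarrow> lunit a' \<cdot> (Ide C unit \<boxtimes>\<^sub>a f) = f \<cdot> lunit a"
    and runit_Hom: "a \<in> Obj C \<Longrightarrow> runit a \<in> Hom C (a \<boxtimes> unit) a"
    and runit_invertible: "a \<in> Obj C \<Longrightarrow> invertible_arr C (runit a)"
    and runit_natural: "f \<in> Hom C a a' \<Longrightarrow> runit a' \<cdot> (f \<boxtimes>\<^sub>a Ide C unit) = f \<cdot> runit a"
    and pentagon: "\<lbrakk>a \<in> Obj C; b \<in> Obj C; c \<in> Obj C; d \<in> Obj C\<rbrakk>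
      \<Longrightarrow> (Ide C a \<boxtimes>\<^sub>a assoc b c d) \<cdot> (assoc a (b \<boxtimes> c) d \<cdot> (assoc a b c \<boxtimes>\<^sub>a Ide C d))
        = assoc a b (c \<boxtimes> d) \<cdot> assoc (a \<boxtimes> b) c d"
    and triangle: "\<lbrakk>a \<in> Obj C; b \<in> Obj C\<rbrakk>
      \<Longrightarrow> (Ide C a \<boxtimes>\<^sub>a lunit b) \<cdot> assoc a unit b = runit a \<boxtimes>\<^sub>a Ide C b"


section \<open>Finite sets and finite monoids\<close>

text \<open>A universe of elements over an arbitrary type of atoms, containing a distinguished point and
  closed under formation of ordered pairs. HOL has no type of all finite sets; the category
  \<open>set\<close> is realised by the finite subsets of this universe. They include every finite set
  of atoms and sets of every finite cardinality, and they have products and a terminal object.\<close>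

datatype 'a elt = Atom 'a | Bullet | Couple "'a elt" "'a elt"

definition fin_set_cat :: "('x set, ('x set, 'x \<Rightarrow> 'x) arrow) cat" where
  "fin_set_cat = \<lparr>
     Obj = {A. finite A},
     Arr = {f. finite (src f) \<and> finite (trg f) \<and> app f \<in> src f \<rightarrow>\<^sub>E trg f},
     Dom = src,
     Cod = trg,
     Ide = (\<lambda>A. \<lparr>src = A, trg = A, app = (\<lambda>x \<in> A. x)\<rparr>),
     Comp = (\<lambda>g f. \<lparr>src = src f, trg = trg g, app = compose (src f) (app g) (app f)\<rparr>)\<rparr>"

text \<open>Only the restriction of a \<open>monoid\<close> record's multiplication to the carrier matters; records
  differing outside the carrier are distinct yet isomorphic objects.\<close>

definition fin_mon_cat :: "('x monoid, ('x monoid, 'x \<Rightarrow> 'x) arrow) cat" where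
  "fin_mon_cat = \<lparr>
     Obj = {M. monoid M \<and> finite (carrier M)},
     Arr = {f. monoid (src f) \<and> finite (carrier (src f)) \<and>
               monoid (trg f) \<and> finite (carrier (trg f)) \<and>
               app f \<in> hom (src f) (trg f) \<and> app f \<one>\<^bsub>src f\<^esub> = \<one>\<^bsub>trg f\<^esub> \<and>
               app f \<in> extensional (carrier (src f))},
     Dom = src,
     Cod = trg,
     Ide = (\<lambda>M. \<lparr>src = M, trg = M, app = (\<lambda>x \<in> carrier M. x)\<rparr>),
     Comp = (\<lambda>g f. \<lparr>src = src f, trg = trg g, app = compose (carrier (src f)) (app g) (app f)\<rparr>)\<rparr>"

definition forget_mon ::
  "('x monoid, ('x monoid, 'x \<Rightarrow> 'x) arrow, 'x set, ('x set, 'x \<Rightarrow> 'x) arrow) fctr" where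
  "forget_mon = \<lparr>
     fobj = carrier,
     farr = (\<lambda>f. \<lparr>src = carrier (src f), trg = carrier (trg f), app = app f\<rparr>)\<rparr>"


section \<open>\<open>\<G>\<close>-sets and \<open>\<G>\<close>-monoids\<close>

type_synonym ('o, 'm, 'x) gset = "('o, 'm, 'x set, ('x set, 'x \<Rightarrow> 'x) arrow) fctr"
type_synonym ('o, 'm, 'x) gmap =
  "(('o, 'm, 'x) gset, 'o \<Rightarrow> ('x set, 'x \<Rightarrow> 'x) arrow) arrow"
type_synonym ('o, 'm, 'x) gmonoid = "('o, 'm, 'x monoid, ('x monoid, 'x \<Rightarrow> 'x) arrow) fctr"

abbreviation gset_cat :: "('o, 'm) cat \<Rightarrow> (('o, 'm, 'x) gset, ('o, 'm, 'x) gmap) cat" where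
  "gset_cat G \<equiv> functor_cat G fin_set_cat"

definition gmonoid :: "('o, 'm) cat \<Rightarrow> ('o, 'm, 'x) gmonoid \<Rightarrow> bool" where
  "gmonoid G S \<longleftrightarrow> is_functor G fin_mon_cat S"

definition underlying :: "('o, 'm) cat \<Rightarrow> ('o, 'm, 'x) gmonoid \<Rightarrow> ('o, 'm, 'x) gset" where
  "underlying G S = comp_functor G forget_mon S"

text \<open>The map from the \<open>G\<close>-set \<open>X\<close> to \<open>Y\<close> whose component at \<open>a\<close>
  is the function \<open>\<phi> a\<close>.\<close>

definition mk_gmap ::
  "('o, 'm) cat \<Rightarrow> ('o, 'm, 'x) gset \<Rightarrow> ('o, 'm, 'x) gset \<Rightarrow> ('o \<Rightarrow> 'x \<Rightarrow> 'x) \<Rightarrow> ('o, 'm, 'x) gmap"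
where
  "mk_gmap G X Y \<phi> = \<lparr>src = X, trg = Y,
     app = (\<lambda>a \<in> Obj G. \<lparr>src = fobj X a, trg = fobj Y a, app = restrict (\<phi> a) (fobj X a)\<rparr>)\<rparr>"

definition set_prod :: "'a elt set \<Rightarrow> 'a elt set \<Rightarrow> 'a elt set" where
  "set_prod A B = {Couple x y | x y. x \<in> A \<and> y \<in> B}"

definition fun_prod :: "('a elt \<Rightarrow> 'a elt) \<Rightarrow> ('a elt \<Rightarrow> 'a elt) \<Rightarrow> 'a elt \<Rightarrow> 'a elt" where
  "fun_prod f g z = (case z of Couple x y \<Rightarrow> Couple (f x) (g y))"

definition gset_prod ::
  "('o, 'm) cat \<Rightarrow> ('o, 'm, 'a elt) gset \<Rightarrow> ('o, 'm, 'a elt) gset \<Rightarrow> ('o, 'm, 'a elt) gset" where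
  "gset_prod G X Y = \<lparr>
     fobj = (\<lambda>a \<in> Obj G. set_prod (fobj X a) (fobj Y a)),
     farr = (\<lambda>u \<in> Arr G. \<lparr>
       src = set_prod (fobj X (Dom G u)) (fobj Y (Dom G u)),
       trg = set_prod (fobj X (Cod G u)) (fobj Y (Cod G u)),
       app = restrict (fun_prod (app (farr X u)) (app (farr Y u)))
               (set_prod (fobj X (Dom G u)) (fobj Y (Dom G u)))\<rparr>)\<rparr>"

definition gset_one :: "('o, 'm) cat \<Rightarrow> ('o, 'm, 'a elt) gset" where
  "gset_one G = \<lparr>fobj = (\<lambda>a \<in> Obj G. {Bullet}), farr = (\<lambda>u \<in> Arr G. Ide fin_set_cat {Bullet})\<rparr>"


section \<open>The monoidal structure on \<open>\<G>\<close>-sets over a \<open>\<G>\<close>-monoid\<close>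

type_synonym ('o, 'm, 'x) slice_arr = "(('o, 'm, 'x) gmap, ('o, 'm, 'x) gmap) arrow"

abbreviation gset_slice ::
  "('o, 'm) cat \<Rightarrow> ('o, 'm, 'x) gmonoid \<Rightarrow> (('o, 'm, 'x) gmap, ('o, 'm, 'x) slice_arr) cat" where
  "gset_slice G S \<equiv> slice_cat (gset_cat G) (underlying G S)"

definition tensor_obj :: "('o, 'm) cat \<Rightarrow> ('o, 'm, 'a elt) gmonoid \<Rightarrow>
    ('o, 'm, 'a elt) gmap \<Rightarrow> ('o, 'm, 'a elt) gmap \<Rightarrow> ('o, 'm, 'a elt) gmap" where
  "tensor_obj G S \<theta> \<tau> = mk_gmap G (gset_prod G (src \<theta>) (src \<tau>)) (underlying G S)
     (\<lambda>a z. case z of Couple x y \<Rightarrow> app (app \<theta> a) x \<otimes>\<^bsub>fobj S a\<^esub> app (app \<tau> a) y)"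

definition tensor_arr :: "('o, 'm) cat \<Rightarrow> ('o, 'm, 'a elt) gmonoid \<Rightarrow>
    ('o, 'm, 'a elt) slice_arr \<Rightarrow> ('o, 'm, 'a elt) slice_arr \<Rightarrow> ('o, 'm, 'a elt) slice_arr" where
  "tensor_arr G S h k = \<lparr>
     src = tensor_obj G S (src h) (src k),
     trg = tensor_obj G S (trg h) (trg k),
     app = mk_gmap G
       (gset_prod G (src (app h)) (src (app k))) (gset_prod G (trg (app h)) (trg (app k)))
       (\<lambda>a. fun_prod (app (app (app h) a)) (app (app (app k) a)))\<rparr>"

definition unit_obj :: "('o, 'm) cat \<Rightarrow> ('o, 'm, 'a elt) gmonoid \<Rightarrow> ('o, 'm, 'a elt) gmap" where
  "unit_obj G S = mk_gmap G (gset_one G) (underlying G S) (\<lambda>a _. \<one>\<^bsub>fobj S a\<^esub>)"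

definition associator :: "('o, 'm) cat \<Rightarrow> ('o, 'm, 'a elt) gmonoid \<Rightarrow>
    ('o, 'm, 'a elt) gmap \<Rightarrow> ('o, 'm, 'a elt) gmap \<Rightarrow> ('o, 'm, 'a elt) gmap \<Rightarrow>
    ('o, 'm, 'a elt) slice_arr" where
  "associator G S \<theta> \<tau> \<rho> = \<lparr>
     src = tensor_obj G S (tensor_obj G S \<theta> \<tau>) \<rho>,
     trg = tensor_obj G S \<theta> (tensor_obj G S \<tau> \<rho>),
     app = mk_gmap G
       (gset_prod G (gset_prod G (src \<theta>) (src \<tau>)) (src \<rho>))
       (gset_prod G (src \<theta>) (gset_prod G (src \<tau>) (src \<rho>)))
       (\<lambda>a w. case w of Couple (Couple x y) z \<Rightarrow> Couple x (Couple y z))\<rparr>"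

definition left_unitor :: "('o, 'm) cat \<Rightarrow> ('o, 'm, 'a elt) gmonoid \<Rightarrow>
    ('o, 'm, 'a elt) gmap \<Rightarrow> ('o, 'm, 'a elt) slice_arr" where
  "left_unitor G S \<theta> = \<lparr>
     src = tensor_obj G S (unit_obj G S) \<theta>,
     trg = \<theta>,
     app = mk_gmap G (gset_prod G (gset_one G) (src \<theta>)) (src \<theta>)
       (\<lambda>a w. case w of Couple _ x \<Rightarrow> x)\<rparr>"

definition right_unitor :: "('o, 'm) cat \<Rightarrow> ('o, 'm, 'a elt) gmonoid \<Rightarrow>
    ('o, 'm, 'a elt) gmap \<Rightarrow> ('o, 'm, 'a elt) slice_arr" where
  "right_unitor G S \<theta> = \<lparr>
     src = tensor_obj G S \<theta> (unit_obj G S),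
     trg = \<theta>,
     app = mk_gmap G (gset_prod G (src \<theta>) (gset_one G)) (src \<theta>)
       (\<lambda>a w. case w of Couple x _ \<Rightarrow> x)\<rparr>"

end

theory Submission
  imports Defs
begin

text \<open>
  The categories \<open>set\<^sup>G\<close> and \<open>set\<^sup>G/S\<close> are categories for general
  reasons: functor categories (\<open>functor_category\<close>) and slices (\<open>slice_category\<close>)
  always are. The monoidal structure is then a matter of elements. An arrow of the slice is
  determined by its source, its target and the values of its components (\<open>slice_eqI\<close>), and a
  family of functions between given objects is an arrow as soon as it is equivariant and commutes
  with the maps to \<open>S\<close> (\<open>mk_gmap_Arr\<close>, \<open>slice_ArrI\<close>).

  The monoid axioms and the functoriality of \<open>S\<close> enter only when the structure is shown to live
  over \<open>S\<close>. That \<open>\<theta> \<otimes> \<tau>\<close> and \<open>I\<close> are equivariant says that \<open>S\<close> acts by monoid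
  homomorphisms; that the associator and the unitors commute with the maps to \<open>S\<close> says that
  multiplication in every \<open>S(a)\<close> is associative and unital.

  Everything else concerns the underlying sets alone. Functoriality of the tensor product,
  naturality, the pentagon and the triangle hold because both sides of each equation rearrange
  nested pairs in the same way. The associator and the unitors are invertible because they are
  bijective at every object, and the pointwise inverse of a bijective arrow is again equivariant and
  again over \<open>S\<close> (\<open>bijective_slice_arr_invertible\<close>).
\<close>

section \<open>Functor categories and slice categories\<close>

lemma fin_set_category: "category fin_set_cat"
  by unfold_locales
    (auto simp: fin_set_cat_def Hom_def compose_def PiE_def Pi_def extensional_def
      intro!: arrow.equality ext)

lemma functor_category:
  assumes "category C" "category D"
  shows "category (functor_cat C D)"
proof -
  interpret C: category C by fact
  interpret D: category D by fact
  have nt_id: "nat_trans C D \<lparr>src = F, trg = F, app = (\<lambda>a \<in> Obj C. Ide D (fobj F a))\<rparr>"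
    if F: "is_functor C D F" for F
    using F unfolding nat_trans_def is_functor_def
    by (auto simp: C.Dom_Obj C.Cod_Obj D.Ide_Hom D.Comp_Ide_left D.Comp_Ide_right)
  have nt_comp: "nat_trans C D
      \<lparr>src = src \<eta>, trg = trg \<tau>, app = (\<lambda>a \<in> Obj C. app \<tau> a \<cdot>\<^bsub>D\<^esub> app \<eta> a)\<rparr>"
    if \<eta>: "nat_trans C D \<eta>" and \<tau>: "nat_trans C D \<tau>" and eq: "trg \<eta> = src \<tau>" for \<eta> \<tau>
  proof -
    have comp: "app \<tau> a \<cdot>\<^bsub>D\<^esub> app \<eta> a \<in> Hom D (fobj (src \<eta>) a) (fobj (trg \<tau>) a)"
      if "a \<in> Obj C" for a
      using \<eta> \<tau> eq that unfolding nat_trans_def by (metis D.Comp_Hom)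
    have nat: "(app \<tau> (Cod C f) \<cdot>\<^bsub>D\<^esub> app \<eta> (Cod C f)) \<cdot>\<^bsub>D\<^esub> farr (src \<eta>) f
        = farr (trg \<tau>) f \<cdot>\<^bsub>D\<^esub> (app \<tau> (Dom C f) \<cdot>\<^bsub>D\<^esub> app \<eta> (Dom C f))"
      if f: "f \<in> Arr C" for f
    proof -
      let ?a = "Dom C f" and ?b = "Cod C f"
      have ab: "?a \<in> Obj C" "?b \<in> Obj C" using f by (simp_all add: C.Dom_Obj C.Cod_Obj)
      have h: "app \<eta> ?a \<in> Hom D (fobj (src \<eta>) ?a) (fobj (src \<tau>) ?a)"
        "app \<eta> ?b \<in> Hom D (fobj (src \<eta>) ?b) (fobj (src \<tau>) ?b)"
        "app \<tau> ?a \<in> Hom D (fobj (src \<tau>) ?a) (fobj (trg \<tau>) ?a)"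
        "app \<tau> ?b \<in> Hom D (fobj (src \<tau>) ?b) (fobj (trg \<tau>) ?b)"
        "farr (src \<eta>) f \<in> Hom D (fobj (src \<eta>) ?a) (fobj (src \<eta>) ?b)"
        "farr (src \<tau>) f \<in> Hom D (fobj (src \<tau>) ?a) (fobj (src \<tau>) ?b)"
        "farr (trg \<tau>) f \<in> Hom D (fobj (trg \<tau>) ?a) (fobj (trg \<tau>) ?b)"
        and n: "app \<eta> ?b \<cdot>\<^bsub>D\<^esub> farr (src \<eta>) f = farr (src \<tau>) f \<cdot>\<^bsub>D\<^esub> app \<eta> ?a"
        "app \<tau> ?b \<cdot>\<^bsub>D\<^esub> farr (src \<tau>) f = farr (trg \<tau>) f \<cdot>\<^bsub>D\<^esub> app \<tau> ?a"
        using \<eta> \<tau> eq f ab unfolding nat_trans_def is_functor_def by auto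
      \<comment> \<open>Paste the naturality squares of \<open>\<eta>\<close> and \<open>\<tau>\<close> along \<open>farr (src \<tau>) f\<close>;
        the three instances of associativity move the brackets between the squares.\<close>
      show ?thesis
        using D.Comp_assoc[OF h(5,2,4)] D.Comp_assoc[OF h(1,6,4)] D.Comp_assoc[OF h(1,3,7)] n
        by simp
    qed
    show ?thesis
      using \<eta> \<tau> comp nat unfolding nat_trans_def by (simp add: C.Dom_Obj C.Cod_Obj)
  qed
  have hom: "app \<eta> a \<in> Hom D (fobj (src \<eta>) a) (fobj (trg \<eta>) a)"
    if "nat_trans C D \<eta>" "a \<in> Obj C" for \<eta> a
    using that unfolding nat_trans_def by auto
  show ?thesis
  proof
    fix f a b assume "f \<in> Hom (functor_cat C D) a b"
    then have f: "nat_trans C D f" "app f \<in> extensional (Obj C)" "src f = a" "trg f = b"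
      by (auto simp: functor_cat_def Hom_def)
    have "app f c \<cdot>\<^bsub>D\<^esub> Ide D (fobj a c) = app f c" "Ide D (fobj b c) \<cdot>\<^bsub>D\<^esub> app f c = app f c"
      if "c \<in> Obj C" for c
      using hom[OF f(1) that] f by (simp_all add: D.Comp_Ide_left D.Comp_Ide_right)
    with f show "f \<cdot>\<^bsub>functor_cat C D\<^esub> Ide (functor_cat C D) a = f"
      "Ide (functor_cat C D) b \<cdot>\<^bsub>functor_cat C D\<^esub> f = f"
      by (auto simp: functor_cat_def intro!: arrow.equality extensionalityI[of _ "Obj C"])
  next
    fix f a b g c h d
    assume "f \<in> Hom (functor_cat C D) a b" "g \<in> Hom (functor_cat C D) b c"
      "h \<in> Hom (functor_cat C D) c d"
    then have f: "nat_trans C D f" "src f = a" "trg f = b"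
      and g: "nat_trans C D g" "src g = b" "trg g = c"
      and h: "nat_trans C D h" "src h = c" "trg h = d"
      by (auto simp: functor_cat_def Hom_def)
    have "(app h x \<cdot>\<^bsub>D\<^esub> app g x) \<cdot>\<^bsub>D\<^esub> app f x = app h x \<cdot>\<^bsub>D\<^esub> (app g x \<cdot>\<^bsub>D\<^esub> app f x)"
      if x: "x \<in> Obj C" for x
      using hom[OF f(1) x] hom[OF g(1) x] hom[OF h(1) x] f g h by (metis D.Comp_assoc)
    then show "(h \<cdot>\<^bsub>functor_cat C D\<^esub> g) \<cdot>\<^bsub>functor_cat C D\<^esub> f
        = h \<cdot>\<^bsub>functor_cat C D\<^esub> (g \<cdot>\<^bsub>functor_cat C D\<^esub> f)"
      by (auto simp: functor_cat_def intro!: arrow.equality)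
  qed (auto simp: functor_cat_def Hom_def nt_id nt_comp, auto simp: nat_trans_def)
qed

lemma slice_category:
  assumes "category D"
  shows "category (slice_cat D s)"
proof -
  interpret D: category D by fact
  have arr: "f \<in> Hom D (Dom D f) (Cod D f)" if "f \<in> Arr D" for f
    using that by (simp add: Hom_def)
  show ?thesis
  proof
    fix a assume "a \<in> Obj (slice_cat D s)"
    then show "Ide (slice_cat D s) a \<in> Hom (slice_cat D s) a a"
      using D.Ide_Hom D.Dom_Obj D.Comp_Ide_right[OF arr] by (auto simp: slice_cat_def Hom_def)
  next
    fix f a b g c
    assume f: "f \<in> Hom (slice_cat D s) a b" and g: "g \<in> Hom (slice_cat D s) b c"
    have c: "c \<in> Hom D (Dom D c) s" "trg g = c" "trg f = b" "src g = b" "src f = a"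
      using f g by (auto simp: slice_cat_def Hom_def)
    have hf: "app f \<in> Hom D (Dom D a) (Dom D b)" and hg: "app g \<in> Hom D (Dom D b) (Dom D c)"
      using f g by (auto simp: slice_cat_def Hom_def)
    have "c \<cdot>\<^bsub>D\<^esub> (app g \<cdot>\<^bsub>D\<^esub> app f) = a"
      using D.Comp_assoc[OF hf hg c(1)] f g by (auto simp: slice_cat_def Hom_def)
    with D.Comp_Hom[OF hf hg] f g
    show "g \<cdot>\<^bsub>slice_cat D s\<^esub> f \<in> Hom (slice_cat D s) a c"
      by (auto simp: slice_cat_def Hom_def)
  next
    fix f a b assume "f \<in> Hom (slice_cat D s) a b"
    then have "app f \<in> Hom D (Dom D a) (Dom D b)" "src f = a" "trg f = b"
      by (auto simp: slice_cat_def Hom_def)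
    then show "f \<cdot>\<^bsub>slice_cat D s\<^esub> Ide (slice_cat D s) a = f"
      "Ide (slice_cat D s) b \<cdot>\<^bsub>slice_cat D s\<^esub> f = f"
      by (auto simp: slice_cat_def D.Comp_Ide_left D.Comp_Ide_right intro!: arrow.equality)
  next
    fix f a b g c h d
    assume "f \<in> Hom (slice_cat D s) a b" "g \<in> Hom (slice_cat D s) b c"
      "h \<in> Hom (slice_cat D s) c d"
    then have "app f \<in> Hom D (Dom D a) (Dom D b)" "app g \<in> Hom D (Dom D b) (Dom D c)"
      "app h \<in> Hom D (Dom D c) (Dom D d)"
      by (auto simp: slice_cat_def Hom_def)
    then show "(h \<cdot>\<^bsub>slice_cat D s\<^esub> g) \<cdot>\<^bsub>slice_cat D s\<^esub> f
        = h \<cdot>\<^bsub>slice_cat D s\<^esub> (g \<cdot>\<^bsub>slice_cat D s\<^esub> f)"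
      by (auto simp: slice_cat_def D.Comp_assoc intro!: arrow.equality)
  qed (auto simp: slice_cat_def Hom_def)
qed


section \<open>\<open>\<G>\<close>-sets and \<open>\<G>\<close>-maps elementwise\<close>

abbreviation act :: "('o, 'm, 'x) gset \<Rightarrow> 'm \<Rightarrow> 'x \<Rightarrow> 'x" where
  "act X u x \<equiv> app (farr X u) x"

abbreviation component :: "('o, 'm, 'x) gmap \<Rightarrow> 'o \<Rightarrow> 'x \<Rightarrow> 'x" where
  "component \<eta> a x \<equiv> app (app \<eta> a) x"

lemma gset_cat_simps [simp]:
  "Dom (gset_cat G) = src" "Cod (gset_cat G) = trg"
  by (simp_all add: functor_cat_def)

context category
begin

lemma Ide_simps [simp]:
  assumes "a \<in> Obj C"
  shows "Ide C a \<in> Arr C" "Dom C (Ide C a) = a" "Cod C (Ide C a) = a"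
  using Ide_Hom[OF assms] by (auto simp: Hom_def)

lemma Comp_simps [simp]:
  assumes "u \<in> Arr C" "v \<in> Arr C" "Cod C u = Dom C v"
  shows "v \<cdot> u \<in> Arr C" "Dom C (v \<cdot> u) = Dom C u" "Cod C (v \<cdot> u) = Cod C v"
  using Comp_Hom[of u "Dom C u" "Cod C u" v "Cod C v"] assms by (auto simp: Hom_def)

lemma gset_category: "category (gset_cat C)"
  using fin_set_category category_axioms by (rule functor_category[rotated])

text \<open>The functor laws, read off elementwise. The conditions on source, target and extensionality make
  equality of arrows of \<open>fin_set_cat\<close> the same as equality of values.\<close>

lemma gsetI:
  assumes "ext_functor C X"
    and "\<And>a. a \<in> Obj C \<Longrightarrow> finite (fobj X a)"
    and "\<And>u. u \<in> Arr C \<Longrightarrow> src (farr X u) = fobj X (Dom C u)"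
    and "\<And>u. u \<in> Arr C \<Longrightarrow> trg (farr X u) = fobj X (Cod C u)"
    and "\<And>u. u \<in> Arr C \<Longrightarrow> app (farr X u) \<in> extensional (fobj X (Dom C u))"
    and "\<And>u x. u \<in> Arr C \<Longrightarrow> x \<in> fobj X (Dom C u) \<Longrightarrow> act X u x \<in> fobj X (Cod C u)"
    and "\<And>a x. a \<in> Obj C \<Longrightarrow> x \<in> fobj X a \<Longrightarrow> act X (Ide C a) x = x"
    and "\<And>u v x. u \<in> Arr C \<Longrightarrow> v \<in> Arr C \<Longrightarrow> Cod C u = Dom C v \<Longrightarrow> x \<in> fobj X (Dom C u) \<Longrightarrow>
           act X (v \<cdot> u) x = act X v (act X u x)"
  shows "X \<in> Obj (gset_cat C)"
proof -
  have "farr X (Ide C a) = Ide fin_set_cat (fobj X a)" if a: "a \<in> Obj C" for a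
    using assms(3-5)[of "Ide C a"] assms(7) a
    by (auto simp: fin_set_cat_def intro!: arrow.equality extensionalityI[of _ "fobj X a"])
  moreover have "farr X (v \<cdot> u) = farr X v \<cdot>\<^bsub>fin_set_cat\<^esub> farr X u"
    if uv: "u \<in> Arr C" "v \<in> Arr C" "Cod C u = Dom C v" for u v
    using assms(3-5)[of "v \<cdot> u"] assms(3-5)[of u] assms(3-5)[of v] assms(6,8) uv
    by (auto simp: fin_set_cat_def compose_def
        intro!: arrow.equality extensionalityI[of _ "fobj X (Dom C u)"])
  moreover have "farr X u \<in> Hom fin_set_cat (fobj X (Dom C u)) (fobj X (Cod C u))"
    if "u \<in> Arr C" for u
    using assms that by (auto simp: fin_set_cat_def Hom_def PiE_def Dom_Obj Cod_Obj)
  moreover have "fobj X a \<in> Obj fin_set_cat" if "a \<in> Obj C" for a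
    using assms that by (simp add: fin_set_cat_def)
  ultimately show ?thesis
    using assms(1) by (simp add: functor_cat_def is_functor_def)
qed

lemma gsetD:
  assumes X: "X \<in> Obj (gset_cat C)"
  shows gset_finite: "a \<in> Obj C \<Longrightarrow> finite (fobj X a)"
    and gset_src: "u \<in> Arr C \<Longrightarrow> src (farr X u) = fobj X (Dom C u)"
    and gset_trg: "u \<in> Arr C \<Longrightarrow> trg (farr X u) = fobj X (Cod C u)"
    and act_closed: "u \<in> Arr C \<Longrightarrow> b = Cod C u \<Longrightarrow> x \<in> fobj X (Dom C u) \<Longrightarrow> act X u x \<in> fobj X b"
    and act_Ide: "a \<in> Obj C \<Longrightarrow> x \<in> fobj X a \<Longrightarrow> act X (Ide C a) x = x"
    and act_Comp: "u \<in> Arr C \<Longrightarrow> v \<in> Arr C \<Longrightarrow> Cod C u = Dom C v \<Longrightarrow> x \<in> fobj X (Dom C u) \<Longrightarrow>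
           act X (v \<cdot> u) x = act X v (act X u x)"
proof -
  have F: "is_functor C fin_set_cat X"
    using X by (auto simp: functor_cat_def)
  show "a \<in> Obj C \<Longrightarrow> finite (fobj X a)"
    using F by (auto simp: is_functor_def fin_set_cat_def)
  have H: "farr X u \<in> Hom fin_set_cat (fobj X (Dom C u)) (fobj X (Cod C u))" if "u \<in> Arr C" for u
    using F that by (auto simp: is_functor_def)
  show "u \<in> Arr C \<Longrightarrow> src (farr X u) = fobj X (Dom C u)"
    "u \<in> Arr C \<Longrightarrow> trg (farr X u) = fobj X (Cod C u)"
    "u \<in> Arr C \<Longrightarrow> b = Cod C u \<Longrightarrow> x \<in> fobj X (Dom C u) \<Longrightarrow> act X u x \<in> fobj X b"
    using H by (fastforce simp: Hom_def fin_set_cat_def PiE_def)+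
  show "a \<in> Obj C \<Longrightarrow> x \<in> fobj X a \<Longrightarrow> act X (Ide C a) x = x"
    using F by (auto simp: is_functor_def fin_set_cat_def)
  show "act X (v \<cdot> u) x = act X v (act X u x)"
    if "u \<in> Arr C" "v \<in> Arr C" "Cod C u = Dom C v" "x \<in> fobj X (Dom C u)"
    using F H[OF that(1)] that by (auto simp: is_functor_def fin_set_cat_def Hom_def compose_def)
qed

text \<open>Several conclusions name an object that is determined by another term (\<open>b = Cod C u\<close>,
  \<open>trg \<eta> = Y\<close>, \<open>src \<eta> = X\<close>). In this form they still match after that term has
  been simplified, for instance to a product of \<open>\<G>\<close>-sets.\<close>

lemma gmapD:
  assumes \<eta>: "\<eta> \<in> Arr (gset_cat C)"
  shows gmap_src: "src \<eta> \<in> Obj (gset_cat C)"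
    and gmap_ext: "app \<eta> \<in> extensional (Obj C)"
    and gmap_component_src: "a \<in> Obj C \<Longrightarrow> src (app \<eta> a) = fobj (src \<eta>) a"
    and gmap_component_trg: "a \<in> Obj C \<Longrightarrow> trg (app \<eta> a) = fobj (trg \<eta>) a"
    and gmap_component_ext: "a \<in> Obj C \<Longrightarrow> app (app \<eta> a) \<in> extensional (fobj (src \<eta>) a)"
    and component_closed: "a \<in> Obj C \<Longrightarrow> trg \<eta> = Y \<Longrightarrow> x \<in> fobj (src \<eta>) a \<Longrightarrow> component \<eta> a x \<in> fobj Y a"
    and equivariant: "u \<in> Arr C \<Longrightarrow> b = Cod C u \<Longrightarrow> src \<eta> = X \<Longrightarrow> x \<in> fobj X (Dom C u) \<Longrightarrow>
           component \<eta> b (act X u x) = act (trg \<eta>) u (component \<eta> (Dom C u) x)"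
proof -
  have N: "nat_trans C fin_set_cat \<eta>"
    using \<eta> by (auto simp: functor_cat_def)
  show src: "src \<eta> \<in> Obj (gset_cat C)" and "app \<eta> \<in> extensional (Obj C)"
    using \<eta> by (auto simp: functor_cat_def nat_trans_def)
  have H: "app \<eta> a \<in> Hom fin_set_cat (fobj (src \<eta>) a) (fobj (trg \<eta>) a)" if "a \<in> Obj C" for a
    using N that by (auto simp: nat_trans_def)
  then show c: "a \<in> Obj C \<Longrightarrow> src (app \<eta> a) = fobj (src \<eta>) a"
    "a \<in> Obj C \<Longrightarrow> trg (app \<eta> a) = fobj (trg \<eta>) a"
    "a \<in> Obj C \<Longrightarrow> app (app \<eta> a) \<in> extensional (fobj (src \<eta>) a)"
    "a \<in> Obj C \<Longrightarrow> trg \<eta> = Y \<Longrightarrow> x \<in> fobj (src \<eta>) a \<Longrightarrow> component \<eta> a x \<in> fobj Y a" for a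
    by (fastforce simp: Hom_def fin_set_cat_def PiE_def)+
  show "component \<eta> b (act X u x) = act (trg \<eta>) u (component \<eta> (Dom C u) x)"
    if u: "u \<in> Arr C" "b = Cod C u" "src \<eta> = X" "x \<in> fobj X (Dom C u)"
  proof -
    have "app (app \<eta> (Cod C u) \<cdot>\<^bsub>fin_set_cat\<^esub> farr (src \<eta>) u) x
        = app (farr (trg \<eta>) u \<cdot>\<^bsub>fin_set_cat\<^esub> app \<eta> (Dom C u)) x"
      using N u by (simp add: nat_trans_def)
    then show ?thesis
      using u gset_src[OF src] c(1)[OF Dom_Obj]
      by (simp add: fin_set_cat_def compose_def)
  qed
qed

lemma gmap_eqI:
  assumes \<eta>: "\<eta> \<in> Arr (gset_cat C)" and \<tau>: "\<tau> \<in> Arr (gset_cat C)"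
    and s: "src \<eta> = src \<tau>" and t: "trg \<eta> = trg \<tau>"
    and eq: "\<And>a x. a \<in> Obj C \<Longrightarrow> x \<in> fobj (src \<eta>) a \<Longrightarrow> component \<eta> a x = component \<tau> a x"
  shows "\<eta> = \<tau>"
proof -
  have "app \<eta> a = app \<tau> a" if a: "a \<in> Obj C" for a
    using eq[OF a] gmapD(3-5)[OF \<eta> a] gmapD(3-5)[OF \<tau> a] s t
    by (auto intro!: arrow.equality extensionalityI[of _ "fobj (src \<eta>) a"])
  then have "app \<eta> = app \<tau>"
    using gmap_ext[OF \<eta>] gmap_ext[OF \<tau>] by (intro extensionalityI[of _ "Obj C"]) auto
  with s t show ?thesis by (auto intro: arrow.equality)
qed

text \<open>A naturality square in \<open>fin_set_cat\<close> commutes if and only if it commutes on elements, so an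
  equivariant family of functions is a \<open>\<G>\<close>-map. All the structure maps below are obtained
  in this way.\<close>

lemma mk_gmap_Arr:
  assumes X: "X \<in> Obj (gset_cat C)" and Y: "Y \<in> Obj (gset_cat C)"
    and map: "\<And>a x. a \<in> Obj C \<Longrightarrow> x \<in> fobj X a \<Longrightarrow> \<phi> a x \<in> fobj Y a"
    and equi: "\<And>u x. u \<in> Arr C \<Longrightarrow> x \<in> fobj X (Dom C u) \<Longrightarrow>
      \<phi> (Cod C u) (act X u x) = act Y u (\<phi> (Dom C u) x)"
  shows "mk_gmap C X Y \<phi> \<in> Arr (gset_cat C)"
proof -
  let ?\<eta> = "mk_gmap C X Y \<phi>"
  have "app ?\<eta> (Cod C u) \<cdot>\<^bsub>fin_set_cat\<^esub> farr X u = farr Y u \<cdot>\<^bsub>fin_set_cat\<^esub> app ?\<eta> (Dom C u)"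
    if u: "u \<in> Arr C" for u
    using u equi[OF u] gset_src[OF X u] gset_trg[OF Y u] act_closed[OF X u]
    by (auto simp: fin_set_cat_def mk_gmap_def compose_def Dom_Obj Cod_Obj intro!: restrict_ext)
  moreover have "app ?\<eta> a \<in> Hom fin_set_cat (fobj X a) (fobj Y a)" if "a \<in> Obj C" for a
    using map that gset_finite[OF X] gset_finite[OF Y]
    by (auto simp: fin_set_cat_def mk_gmap_def Hom_def)
  ultimately show ?thesis
    using X Y by (auto simp: functor_cat_def nat_trans_def mk_gmap_def)
qed

end

lemma mk_gmap_simps [simp]:
  "src (mk_gmap G X Y \<phi>) = X" "trg (mk_gmap G X Y \<phi>) = Y"
  "a \<in> Obj G \<Longrightarrow> x \<in> fobj X a \<Longrightarrow> component (mk_gmap G X Y \<phi>) a x = \<phi> a x"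
  by (simp_all add: mk_gmap_def)


section \<open>Products of \<open>\<G>\<close>-sets\<close>

lemma Couple_in_set_prod [simp]: "Couple x y \<in> set_prod A B \<longleftrightarrow> x \<in> A \<and> y \<in> B"
  by (simp add: set_prod_def)

lemma set_prodE [elim!]:
  assumes "z \<in> set_prod A B"
  obtains x y where "z = Couple x y" "x \<in> A" "y \<in> B"
  using assms by (auto simp: set_prod_def)

lemma fun_prod_Couple [simp]: "fun_prod f g (Couple x y) = Couple (f x) (g y)"
  by (simp add: fun_prod_def)

lemma finite_set_prod: "finite A \<Longrightarrow> finite B \<Longrightarrow> finite (set_prod A B)"
  by (rule finite_subset[of _ "(\<lambda>(x, y). Couple x y) ` (A \<times> B)"]) auto

lemma fobj_gset_prod [simp]:
  "a \<in> Obj G \<Longrightarrow> fobj (gset_prod G X Y) a = set_prod (fobj X a) (fobj Y a)"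
  by (simp add: gset_prod_def)

lemma act_gset_prod [simp]:
  "u \<in> Arr G \<Longrightarrow> x \<in> fobj X (Dom G u) \<Longrightarrow> y \<in> fobj Y (Dom G u) \<Longrightarrow>
    act (gset_prod G X Y) u (Couple x y) = Couple (act X u x) (act Y u y)"
  by (simp add: gset_prod_def)

lemma fobj_gset_one [simp]: "a \<in> Obj G \<Longrightarrow> fobj (gset_one G) a = {Bullet}"
  by (simp add: gset_one_def)

lemma act_gset_one [simp]: "u \<in> Arr G \<Longrightarrow> act (gset_one G) u Bullet = Bullet"
  by (simp add: gset_one_def fin_set_cat_def)

context category
begin

lemma gset_prod_Obj [simp]:
  assumes X: "X \<in> Obj (gset_cat C)" and Y: "Y \<in> Obj (gset_cat C)"
  shows "gset_prod C X Y \<in> Obj (gset_cat C)"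
proof (rule gsetI)
  show "ext_functor C (gset_prod C X Y)"
    by (simp add: ext_functor_def gset_prod_def)
qed (auto simp: Dom_Obj Cod_Obj finite_set_prod gset_finite[OF X] gset_finite[OF Y]
       act_closed[OF X] act_closed[OF Y] act_Ide[OF X] act_Ide[OF Y] act_Comp[OF X] act_Comp[OF Y],
     auto simp: gset_prod_def)

lemma gset_one_Obj [simp]: "gset_one C \<in> Obj (gset_cat C)"
proof (rule gsetI)
  show "ext_functor C (gset_one C)"
    by (simp add: ext_functor_def gset_one_def)
qed (auto simp: Dom_Obj Cod_Obj, auto simp: gset_one_def fin_set_cat_def Dom_Obj Cod_Obj)

end


section \<open>The slice over a \<open>\<G>\<close>-monoid elementwise\<close>

locale gmonoid_over = category G for G :: "('o, 'm) cat" (structure) +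
  fixes S :: "('o, 'm, 'x) gmonoid"
  assumes gmonoid: "gmonoid G S"
begin

abbreviation "\<S> \<equiv> gset_slice G S"

abbreviation val :: "('o, 'm, 'x) slice_arr \<Rightarrow> 'o \<Rightarrow> 'x \<Rightarrow> 'x" where
  "val h a x \<equiv> component (app h) a x"

lemma S_simps:
  shows S_monoid: "a \<in> Obj G \<Longrightarrow> monoid (fobj S a)"
    and S_finite: "a \<in> Obj G \<Longrightarrow> finite (carrier (fobj S a))"
    and S_mult: "u \<in> Arr G \<Longrightarrow> x \<in> carrier (fobj S (Dom G u)) \<Longrightarrow> y \<in> carrier (fobj S (Dom G u)) \<Longrightarrow>
      app (farr S u) (x \<otimes>\<^bsub>fobj S (Dom G u)\<^esub> y)
        = app (farr S u) x \<otimes>\<^bsub>fobj S (Cod G u)\<^esub> app (farr S u) y"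
    and S_one: "u \<in> Arr G \<Longrightarrow> app (farr S u) \<one>\<^bsub>fobj S (Dom G u)\<^esub> = \<one>\<^bsub>fobj S (Cod G u)\<^esub>"
  using gmonoid unfolding gmonoid_def is_functor_def
  by (auto simp: fin_mon_cat_def Hom_def hom_def)

lemma fobj_underlying [simp]: "a \<in> Obj G \<Longrightarrow> fobj (underlying G S) a = carrier (fobj S a)"
  by (simp add: underlying_def comp_functor_def forget_mon_def)

lemma act_underlying [simp]: "u \<in> Arr G \<Longrightarrow> act (underlying G S) u x = app (farr S u) x"
  by (simp add: underlying_def comp_functor_def forget_mon_def)

lemma underlying_Obj [simp]: "underlying G S \<in> Obj (gset_cat G)"
proof (rule gsetI)
  have F: "is_functor G fin_mon_cat S" using gmonoid by (simp add: gmonoid_def)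
  then have H: "farr S u \<in> Hom fin_mon_cat (fobj S (Dom G u)) (fobj S (Cod G u))"
    if "u \<in> Arr G" for u
    using that by (auto simp: is_functor_def)
  show "ext_functor G (underlying G S)"
    by (simp add: ext_functor_def underlying_def comp_functor_def)
  fix u x assume u: "u \<in> Arr G"
  show "src (farr (underlying G S) u) = fobj (underlying G S) (Dom G u)"
    "trg (farr (underlying G S) u) = fobj (underlying G S) (Cod G u)"
    "app (farr (underlying G S) u) \<in> extensional (fobj (underlying G S) (Dom G u))"
    using u H[OF u]
    by (auto simp: underlying_def comp_functor_def forget_mon_def fin_mon_cat_def Hom_def
        Dom_Obj Cod_Obj)
  assume x: "x \<in> fobj (underlying G S) (Dom G u)"
  then show "act (underlying G S) u x \<in> fobj (underlying G S) (Cod G u)"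
    using u H[OF u] by (auto simp: fin_mon_cat_def Hom_def hom_def Dom_Obj Cod_Obj)
  fix v assume "v \<in> Arr G" "Cod G u = Dom G v"
  then show "act (underlying G S) (v \<cdot> u) x = act (underlying G S) v (act (underlying G S) u x)"
    using u x F H[OF u]
    by (auto simp: is_functor_def fin_mon_cat_def Hom_def compose_def Dom_Obj)
next
  fix a x assume "a \<in> Obj G" "x \<in> fobj (underlying G S) a"
  then show "act (underlying G S) (Ide G a) x = x"
    using gmonoid by (auto simp: gmonoid_def is_functor_def fin_mon_cat_def)
qed (simp add: S_finite)

sublocale slice: category \<S>
  by (rule slice_category[OF gset_category])

lemma slice_cat_simps [simp]:
  "Dom \<S> = src" "Cod \<S> = trg"
  "src (Ide \<S> \<theta>) = \<theta>" "trg (Ide \<S> \<theta>) = \<theta>"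
  "src (g \<cdot>\<^bsub>\<S>\<^esub> f) = src f" "trg (g \<cdot>\<^bsub>\<S>\<^esub> f) = trg g"
  by (simp_all add: slice_cat_def)

lemma app_slice_Comp: "app (g \<cdot>\<^bsub>\<S>\<^esub> f) = app g \<cdot>\<^bsub>gset_cat G\<^esub> app f"
  by (simp add: slice_cat_def)

lemma app_slice_Ide: "app (Ide \<S> \<theta>) = Ide (gset_cat G) (src \<theta>)"
  by (simp add: slice_cat_def)

lemma slice_Obj_iff: "\<theta> \<in> Obj \<S> \<longleftrightarrow> \<theta> \<in> Arr (gset_cat G) \<and> trg \<theta> = underlying G S"
  by (simp add: slice_cat_def)

lemma slice_ObjD:
  assumes "\<theta> \<in> Obj \<S>"
  shows "\<theta> \<in> Arr (gset_cat G)" "trg \<theta> = underlying G S" "src \<theta> \<in> Obj (gset_cat G)"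
  using assms gmap_src by (auto simp: slice_Obj_iff)

lemma slice_Obj_closed [simp]:
  "\<theta> \<in> Obj \<S> \<Longrightarrow> a \<in> Obj G \<Longrightarrow> x \<in> fobj (src \<theta>) a \<Longrightarrow> component \<theta> a x \<in> carrier (fobj S a)"
  using component_closed[of \<theta> a "underlying G S" x] slice_ObjD[of \<theta>] by simp

lemma gset_Comp_component:
  assumes "\<eta> \<in> Arr (gset_cat G)" "a \<in> Obj G" "x \<in> fobj (src \<eta>) a"
  shows "component (\<tau> \<cdot>\<^bsub>gset_cat G\<^esub> \<eta>) a x = component \<tau> a (component \<eta> a x)"
  using assms gmap_component_src[OF assms(1,2)]
  by (simp add: functor_cat_def fin_set_cat_def compose_def)

text \<open>The triangle over \<open>S\<close> is an equation between \<open>\<G>\<close>-maps, so it may be checked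
  on elements.\<close>

lemma slice_ArrI:
  assumes s: "src h \<in> Obj \<S>" and t: "trg h \<in> Obj \<S>"
    and h: "app h \<in> Arr (gset_cat G)" "src (app h) = src (src h)" "trg (app h) = src (trg h)"
    and over: "\<And>a x. a \<in> Obj G \<Longrightarrow> x \<in> fobj (src (src h)) a \<Longrightarrow>
      component (trg h) a (val h a x) = component (src h) a x"
  shows "h \<in> Arr \<S>"
proof -
  interpret gset: category "gset_cat G" by (rule gset_category)
  have "trg h \<cdot>\<^bsub>gset_cat G\<^esub> app h \<in> Arr (gset_cat G)"
    using slice_ObjD[OF t] h by (intro gset.Comp_simps) auto
  moreover have "src (trg h \<cdot>\<^bsub>gset_cat G\<^esub> app h) = src (src h)"
    "trg (trg h \<cdot>\<^bsub>gset_cat G\<^esub> app h) = underlying G S"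
    using slice_ObjD[OF t] h by (auto simp: functor_cat_def)
  ultimately have "trg h \<cdot>\<^bsub>gset_cat G\<^esub> app h = src h"
    using slice_ObjD[OF s] h by (intro gmap_eqI) (auto simp: over gset_Comp_component)
  then show ?thesis
    using slice_ObjD[OF s] slice_ObjD[OF t] h by (auto simp: slice_cat_def Hom_def)
qed

lemma slice_ArrD:
  assumes h: "h \<in> Arr \<S>"
  shows slice_src_Obj [simp]: "src h \<in> Obj \<S>"
    and slice_trg_Obj [simp]: "trg h \<in> Obj \<S>"
    and slice_app_Arr [simp]: "app h \<in> Arr (gset_cat G)"
    and slice_app_src [simp]: "src (app h) = src (src h)"
    and slice_app_trg [simp]: "trg (app h) = src (trg h)"
    and val_closed [simp]: "a \<in> Obj G \<Longrightarrow> trg h = \<tau> \<Longrightarrow> x \<in> fobj (src (src h)) a \<Longrightarrow>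
      val h a x \<in> fobj (src \<tau>) a"
    and val_over [simp]: "a \<in> Obj G \<Longrightarrow> trg h = \<tau> \<Longrightarrow> x \<in> fobj (src (src h)) a \<Longrightarrow>
      component \<tau> a (val h a x) = component (src h) a x"
proof -
  show "src h \<in> Obj \<S>" "trg h \<in> Obj \<S>"
    using h slice.Dom_Obj[OF h] slice.Cod_Obj[OF h] by auto
  show A: "app h \<in> Arr (gset_cat G)" "src (app h) = src (src h)" "trg (app h) = src (trg h)"
    using h by (auto simp: slice_cat_def Hom_def)
  show "a \<in> Obj G \<Longrightarrow> trg h = \<tau> \<Longrightarrow> x \<in> fobj (src (src h)) a \<Longrightarrow> val h a x \<in> fobj (src \<tau>) a"
    using component_closed[OF A(1)] A by auto
  have "trg h \<cdot>\<^bsub>gset_cat G\<^esub> app h = src h"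
    using h by (simp add: slice_cat_def)
  then show "a \<in> Obj G \<Longrightarrow> trg h = \<tau> \<Longrightarrow> x \<in> fobj (src (src h)) a \<Longrightarrow>
      component \<tau> a (val h a x) = component (src h) a x"
    using gset_Comp_component[OF A(1)] A by metis
qed

text \<open>Every coherence law is proved by this principle: it reduces an equation of composite arrows to
  an evaluation on nested pairs.\<close>

lemma slice_eqI:
  assumes "h \<in> Arr \<S>" "k \<in> Arr \<S>" "src h = src k" "trg h = trg k"
    and "\<And>a x. a \<in> Obj G \<Longrightarrow> x \<in> fobj (src (src h)) a \<Longrightarrow> val h a x = val k a x"
  shows "h = k"
  using assms by (intro arrow.equality gmap_eqI) auto

lemma val_Comp [simp]:
  assumes "f \<in> Arr \<S>" "a \<in> Obj G" "x \<in> fobj (src (src f)) a"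
  shows "val (g \<cdot>\<^bsub>\<S>\<^esub> f) a x = val g a (val f a x)"
  using assms by (simp add: app_slice_Comp gset_Comp_component)

lemma val_Ide [simp]:
  assumes "\<theta> \<in> Obj \<S>" "a \<in> Obj G" "x \<in> fobj (src \<theta>) a"
  shows "val (Ide \<S> \<theta>) a x = x"
  unfolding app_slice_Ide using assms by (simp add: functor_cat_def fin_set_cat_def)

text \<open>These facts become rewrite rules only here: together with an unfolding of \<open>slice_cat_def\<close>
  their premise rewrites to a conjunction that contains their own conclusion.\<close>

declare slice_ObjD [simp]

text \<open>If \<open>h\<close> is equivariant and commutes with the maps to \<open>S\<close>, then so does its pointwise
  inverse \<open>\<psi>\<close>: write an element \<open>y\<close> of the target as \<open>h (\<psi> y)\<close> and cancel. Thus
  only bijectivity at each object has to be checked for the structure maps.\<close>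

lemma bijective_slice_arr_invertible:
  assumes h: "h \<in> Arr \<S>"
    and bij: "\<And>a. a \<in> Obj G \<Longrightarrow> bij_betw (val h a) (fobj (src (src h)) a) (fobj (src (trg h)) a)"
  shows "invertible_arr \<S> h"
proof -
  let ?X = "src (src h)" and ?Y = "src (trg h)"
  define \<psi> where "\<psi> a = inv_into (fobj ?X a) (val h a)" for a
  have left: "\<psi> a (val h a x) = x" if "a \<in> Obj G" "x \<in> fobj ?X a" for a x
    using bij[OF that(1)] that(2) unfolding \<psi>_def by (simp add: bij_betw_inv_into_left)
  have right: "val h a (\<psi> a y) = y" if "a \<in> Obj G" "y \<in> fobj ?Y a" for a y
    using bij[OF that(1)] that(2) unfolding \<psi>_def by (simp add: bij_betw_inv_into_right)
  have \<psi>: "\<psi> a y \<in> fobj ?X a" if "a \<in> Obj G" "y \<in> fobj ?Y a" for a y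
    using bij[OF that(1)] that(2) unfolding \<psi>_def by (simp add: bij_betw_def inv_into_into)
  have X: "?X \<in> Obj (gset_cat G)" and Y: "?Y \<in> Obj (gset_cat G)" using h by auto
  have equi: "\<psi> (Cod G u) (act ?Y u y) = act ?X u (\<psi> (Dom G u) y)"
    if u: "u \<in> Arr G" and y: "y \<in> fobj ?Y (Dom G u)" for u y
  proof -
    let ?x = "\<psi> (Dom G u) y"
    have x: "?x \<in> fobj ?X (Dom G u)" using \<psi> u y by (simp add: Dom_Obj)
    have "act ?Y u y = act ?Y u (val h (Dom G u) ?x)"
      using right u y by (simp add: Dom_Obj)
    also have "\<dots> = val h (Cod G u) (act ?X u ?x)"
      using equivariant[of "app h" u "Cod G u" ?X ?x] h u x by simp
    finally show ?thesis
      using left[OF Cod_Obj[OF u] act_closed[OF X u refl x]] by simp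
  qed
  define k where "k = \<lparr>src = trg h, trg = src h, app = mk_gmap G ?Y ?X \<psi>\<rparr>"
  have k_simps: "src k = trg h" "trg k = src h"
    "\<And>a y. a \<in> Obj G \<Longrightarrow> y \<in> fobj ?Y a \<Longrightarrow> val k a y = \<psi> a y"
    by (auto simp: k_def)
  have k: "k \<in> Arr \<S>"
  proof (rule slice_ArrI)
    show "app k \<in> Arr (gset_cat G)"
      unfolding k_def using mk_gmap_Arr[OF Y X, of \<psi>] \<psi> equi by simp
    fix a y assume "a \<in> Obj G" "y \<in> fobj (src (src k)) a"
    then show "component (trg k) a (val k a y) = component (src k) a y"
      using val_over[OF h _ refl, of a "\<psi> a y"] \<psi> right by (simp add: k_simps)
  qed (use h in \<open>auto simp: k_def\<close>)
  have "k \<cdot>\<^bsub>\<S>\<^esub> h = Ide \<S> (src h)"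
    using h k by (intro slice_eqI) (auto simp: k_simps left)
  moreover have "h \<cdot>\<^bsub>\<S>\<^esub> k = Ide \<S> (trg h)"
    using h k by (intro slice_eqI) (auto simp: k_simps right)
  moreover have "k \<in> Hom \<S> (trg h) (src h)"
    using k by (simp add: Hom_def k_simps)
  ultimately show ?thesis
    using h by (auto simp: invertible_arr_def)
qed

end


section \<open>The monoidal structure\<close>

locale elt_gmonoid_over = gmonoid_over G S
  for G :: "('o, 'm) cat" (structure) and S :: "('o, 'm, 'a elt) gmonoid"
begin

abbreviation obj_tensor (infixl "\<boxtimes>" 75) where "\<theta> \<boxtimes> \<tau> \<equiv> tensor_obj G S \<theta> \<tau>"
abbreviation arr_tensor (infixl "\<boxtimes>\<^sub>a" 75) where "h \<boxtimes>\<^sub>a k \<equiv> tensor_arr G S h k"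
abbreviation "I \<equiv> unit_obj G S"

lemma src_tensor_obj [simp]: "src (\<theta> \<boxtimes> \<tau>) = gset_prod G (src \<theta>) (src \<tau>)"
  by (simp add: tensor_obj_def)

lemma src_unit_obj [simp]: "src I = gset_one G"
  by (simp add: unit_obj_def)

lemma component_tensor_obj [simp]:
  "a \<in> Obj G \<Longrightarrow> x \<in> fobj (src \<theta>) a \<Longrightarrow> y \<in> fobj (src \<tau>) a \<Longrightarrow>
    component (\<theta> \<boxtimes> \<tau>) a (Couple x y) = component \<theta> a x \<otimes>\<^bsub>fobj S a\<^esub> component \<tau> a y"
  by (simp add: tensor_obj_def)

lemma component_unit_obj [simp]: "a \<in> Obj G \<Longrightarrow> component I a Bullet = \<one>\<^bsub>fobj S a\<^esub>"
  by (simp add: unit_obj_def)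

text \<open>Equivariance of \<open>(x, y) \<mapsto> \<theta>(x) \<tau>(y)\<close> is the point at which the action on
  \<open>S\<close> has to preserve products.\<close>

lemma tensor_obj_Obj [simp]:
  assumes \<theta>: "\<theta> \<in> Obj \<S>" and \<tau>: "\<tau> \<in> Obj \<S>"
  shows "\<theta> \<boxtimes> \<tau> \<in> Obj \<S>"
proof -
  have "\<theta> \<boxtimes> \<tau> \<in> Arr (gset_cat G)"
    unfolding tensor_obj_def using \<theta> \<tau>
    by (intro mk_gmap_Arr)
      (auto simp: S_monoid monoid.m_closed Dom_Obj Cod_Obj S_mult
        equivariant[where \<eta> = \<theta>] equivariant[where \<eta> = \<tau>])
  then show ?thesis
    unfolding slice_Obj_iff by (simp add: tensor_obj_def)
qed

lemma unit_obj_Obj [simp]: "I \<in> Obj \<S>"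
proof -
  have "I \<in> Arr (gset_cat G)"
    unfolding unit_obj_def
    by (intro mk_gmap_Arr) (auto simp: S_monoid monoid.one_closed Dom_Obj Cod_Obj S_one)
  then show ?thesis
    unfolding slice_Obj_iff by (simp add: unit_obj_def)
qed

lemma tensor_arr_simps [simp]:
  "src (h \<boxtimes>\<^sub>a k) = src h \<boxtimes> src k" "trg (h \<boxtimes>\<^sub>a k) = trg h \<boxtimes> trg k"
  by (simp_all add: tensor_arr_def)

lemma val_tensor_arr [simp]:
  assumes "h \<in> Arr \<S>" "k \<in> Arr \<S>" "a \<in> Obj G" "x \<in> fobj (src (src h)) a" "y \<in> fobj (src (src k)) a"
  shows "val (h \<boxtimes>\<^sub>a k) a (Couple x y) = Couple (val h a x) (val k a y)"
  using assms by (simp add: tensor_arr_def)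

lemma tensor_arr_Arr [simp]:
  assumes h: "h \<in> Arr \<S>" and k: "k \<in> Arr \<S>"
  shows "h \<boxtimes>\<^sub>a k \<in> Arr \<S>"
proof (rule slice_ArrI)
  show "app (h \<boxtimes>\<^sub>a k) \<in> Arr (gset_cat G)"
    unfolding tensor_arr_def arrow.simps using h k
    by (intro mk_gmap_Arr)
      (auto simp: Dom_Obj Cod_Obj equivariant[where \<eta> = "app h"] equivariant[where \<eta> = "app k"])
  show "src (app (h \<boxtimes>\<^sub>a k)) = src (src (h \<boxtimes>\<^sub>a k))" "trg (app (h \<boxtimes>\<^sub>a k)) = src (trg (h \<boxtimes>\<^sub>a k))"
    using h k by (simp_all add: tensor_arr_def)
qed (use h k in auto)

lemma associator_simps [simp]:
  "src (associator G S \<theta> \<tau> \<rho>) = (\<theta> \<boxtimes> \<tau>) \<boxtimes> \<rho>" "trg (associator G S \<theta> \<tau> \<rho>) = \<theta> \<boxtimes> (\<tau> \<boxtimes> \<rho>)"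
  by (simp_all add: associator_def)

lemma val_associator [simp]:
  "a \<in> Obj G \<Longrightarrow> x \<in> fobj (src \<theta>) a \<Longrightarrow> y \<in> fobj (src \<tau>) a \<Longrightarrow> z \<in> fobj (src \<rho>) a \<Longrightarrow>
    val (associator G S \<theta> \<tau> \<rho>) a (Couple (Couple x y) z) = Couple x (Couple y z)"
  by (simp add: associator_def)

lemma left_unitor_simps [simp]:
  "src (left_unitor G S \<theta>) = I \<boxtimes> \<theta>" "trg (left_unitor G S \<theta>) = \<theta>"
  by (simp_all add: left_unitor_def)

lemma val_left_unitor [simp]:
  "a \<in> Obj G \<Longrightarrow> x \<in> fobj (src \<theta>) a \<Longrightarrow> val (left_unitor G S \<theta>) a (Couple Bullet x) = x"
  by (simp add: left_unitor_def)

lemma right_unitor_simps [simp]: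
  "src (right_unitor G S \<theta>) = \<theta> \<boxtimes> I" "trg (right_unitor G S \<theta>) = \<theta>"
  by (simp_all add: right_unitor_def)

lemma val_right_unitor [simp]:
  "a \<in> Obj G \<Longrightarrow> x \<in> fobj (src \<theta>) a \<Longrightarrow> val (right_unitor G S \<theta>) a (Couple x Bullet) = x"
  by (simp add: right_unitor_def)

text \<open>The rebracketing commutes with the maps to \<open>S\<close> exactly by associativity of the monoids
  \<open>S(a)\<close>; for the two unitors, the same role is played by the unit laws.\<close>

lemma associator_Arr [simp]:
  assumes "\<theta> \<in> Obj \<S>" "\<tau> \<in> Obj \<S>" "\<rho> \<in> Obj \<S>"
  shows "associator G S \<theta> \<tau> \<rho> \<in> Arr \<S>"
proof (rule slice_ArrI)
  show "app (associator G S \<theta> \<tau> \<rho>) \<in> Arr (gset_cat G)"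
    unfolding associator_def arrow.simps using assms
    by (intro mk_gmap_Arr) (auto simp: Dom_Obj Cod_Obj act_closed)
  show "src (app (associator G S \<theta> \<tau> \<rho>)) = src (src (associator G S \<theta> \<tau> \<rho>))"
    "trg (app (associator G S \<theta> \<tau> \<rho>)) = src (trg (associator G S \<theta> \<tau> \<rho>))"
    by (simp_all add: associator_def)
qed (use assms in \<open>auto simp: S_monoid monoid.m_assoc\<close>)

lemma left_unitor_Arr [simp]:
  assumes "\<theta> \<in> Obj \<S>"
  shows "left_unitor G S \<theta> \<in> Arr \<S>"
proof (rule slice_ArrI)
  show "app (left_unitor G S \<theta>) \<in> Arr (gset_cat G)"
    unfolding left_unitor_def arrow.simps using assms
    by (intro mk_gmap_Arr) (auto simp: Dom_Obj Cod_Obj)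
  show "src (app (left_unitor G S \<theta>)) = src (src (left_unitor G S \<theta>))"
    "trg (app (left_unitor G S \<theta>)) = src (trg (left_unitor G S \<theta>))"
    by (simp_all add: left_unitor_def)
qed (use assms in \<open>auto simp: S_monoid monoid.l_one\<close>)

lemma right_unitor_Arr [simp]:
  assumes "\<theta> \<in> Obj \<S>"
  shows "right_unitor G S \<theta> \<in> Arr \<S>"
proof (rule slice_ArrI)
  show "app (right_unitor G S \<theta>) \<in> Arr (gset_cat G)"
    unfolding right_unitor_def arrow.simps using assms
    by (intro mk_gmap_Arr) (auto simp: Dom_Obj Cod_Obj)
  show "src (app (right_unitor G S \<theta>)) = src (src (right_unitor G S \<theta>))"
    "trg (app (right_unitor G S \<theta>)) = src (trg (right_unitor G S \<theta>))"
    by (simp_all add: right_unitor_def)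
qed (use assms in \<open>auto simp: S_monoid monoid.r_one\<close>)

lemma associator_invertible:
  assumes "\<theta> \<in> Obj \<S>" "\<tau> \<in> Obj \<S>" "\<rho> \<in> Obj \<S>"
  shows "invertible_arr \<S> (associator G S \<theta> \<tau> \<rho>)"
proof (rule bijective_slice_arr_invertible)
  fix a assume "a \<in> Obj G"
  then show "bij_betw (val (associator G S \<theta> \<tau> \<rho>) a)
      (fobj (src (src (associator G S \<theta> \<tau> \<rho>))) a) (fobj (src (trg (associator G S \<theta> \<tau> \<rho>))) a)"
    by (intro bij_betw_byWitness
        [where f' = "\<lambda>w. case w of Couple x (Couple y z) \<Rightarrow> Couple (Couple x y) z"]) auto
qed (use assms in auto)

lemma left_unitor_invertible:
  assumes "\<theta> \<in> Obj \<S>"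
  shows "invertible_arr \<S> (left_unitor G S \<theta>)"
proof (rule bijective_slice_arr_invertible)
  fix a assume "a \<in> Obj G"
  then show "bij_betw (val (left_unitor G S \<theta>) a)
      (fobj (src (src (left_unitor G S \<theta>))) a) (fobj (src (trg (left_unitor G S \<theta>))) a)"
    by (intro bij_betw_byWitness[where f' = "Couple Bullet"]) auto
qed (use assms in auto)

lemma right_unitor_invertible:
  assumes "\<theta> \<in> Obj \<S>"
  shows "invertible_arr \<S> (right_unitor G S \<theta>)"
proof (rule bijective_slice_arr_invertible)
  fix a assume "a \<in> Obj G"
  then show "bij_betw (val (right_unitor G S \<theta>) a)
      (fobj (src (src (right_unitor G S \<theta>))) a) (fobj (src (trg (right_unitor G S \<theta>))) a)"
    by (intro bij_betw_byWitness[where f' = "\<lambda>x. Couple x Bullet"]) auto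
qed (use assms in auto)

lemma tensor_is_functor:
  "is_functor (product_cat \<S> \<S>) \<S> \<lparr>fobj = (\<lambda>(\<theta>, \<tau>). \<theta> \<boxtimes> \<tau>), farr = (\<lambda>(h, k). h \<boxtimes>\<^sub>a k)\<rparr>"
proof -
  have "Ide \<S> \<theta> \<boxtimes>\<^sub>a Ide \<S> \<tau> = Ide \<S> (\<theta> \<boxtimes> \<tau>)" if "\<theta> \<in> Obj \<S>" "\<tau> \<in> Obj \<S>" for \<theta> \<tau>
    using that by (intro slice_eqI) auto
  moreover have "(h' \<cdot>\<^bsub>\<S>\<^esub> h) \<boxtimes>\<^sub>a (k' \<cdot>\<^bsub>\<S>\<^esub> k) = (h' \<boxtimes>\<^sub>a k') \<cdot>\<^bsub>\<S>\<^esub> (h \<boxtimes>\<^sub>a k)"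
    if "h \<in> Arr \<S>" "h' \<in> Arr \<S>" "k \<in> Arr \<S>" "k' \<in> Arr \<S>" "trg h = src h'" "trg k = src k'"
    for h h' k k'
    using that by (intro slice_eqI) auto
  ultimately show ?thesis
    by (auto simp: is_functor_def product_cat_def Hom_def)
qed

lemma monoidal:
  "monoidal_category \<S> (tensor_obj G S) (tensor_arr G S) I
     (associator G S) (left_unitor G S) (right_unitor G S)"
proof (unfold_locales, goal_cases)
  case 1
  show ?case by (rule tensor_is_functor)
qed (auto simp: Hom_def associator_invertible left_unitor_invertible right_unitor_invertible
      intro!: slice_eqI)

end

theorem theorem3p1:
  fixes G :: "('o, 'm) cat"
    and S :: "('o, 'm, 'a elt) gmonoid"
  assumes "finite_groupoid G"
    and "Obj G \<noteq> {}"
    and "gmonoid G S"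
  shows "monoidal_category (gset_slice G S)
           (tensor_obj G S) (tensor_arr G S) (unit_obj G S)
           (associator G S) (left_unitor G S) (right_unitor G S)"
proof -
  interpret finite_groupoid G by fact
  interpret elt_gmonoid_over G S by unfold_locales fact
  show ?thesis by (rule monoidal)
qed

end
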